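(* Let $n\ge1$ be an integer, let $X$ and $Y$ be metric spaces, and let $f:X\to Y$ be a surjective Lipschitz map such that $|f^{-1}(y)|\le n$ for each $y\in Y$, and such that there exists $d>0$ with the property that for each $r>0$ and for each $B\subset Y$ with $\operatorname{diam}(B)\le r$ there exists $A\subset X$ with $\operatorname{diam}(A)\le dr$ and $f(A)=B$. Then $$\dim_{\mathrm{AN}}Y\le(\dim_{\mathrm{AN}}X+1)\cdot n-1 .$$
   Context: A map $f:(X,d_X)\to(Y,d_Y)$ is Lipschitz if there is $c>0$ with $d_Y(f(x),f(x'))\le c\,d_X(x,x')$ for all $x,x'\in X$. A family $\mathcal U$ of subsets of a metric space is $r$-disjoint if $d(x,x')>r$ for any $x,x'$ belonging to different elements of $\mathcal U$. The Assouad-Nagata dimension satisfies $\dim_{\mathrm{AN}}X\le m$ (with $m\geq 0$ an integer) if there is a constant $c\ge0$ such that for every $0<r<\infty$ there exist $r$-disjoint families $\mathcal U^0,\dots,\mathcal U^m$ of subsets of $X$ whose union covers $X$ and all of whose elements have diameter at most $cr$. $\dim_{\mathrm{AN}}X$ is the least such $m$, and $\infty$ if there is none (in which case the inequality is trivially true). *)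

theory Defs
  imports "HOL-Analysis.Analysis"
begin

(* Extended-real valued, so that unbounded sets have diameter infinity
   (the library's real-valued diameter has no meaningful value there);
   the empty set has diameter 0. *)
definition mdiameter :: "'a metric \<Rightarrow> 'a set \<Rightarrow> ennreal" where
  "mdiameter m S = (SUP x\<in>S. SUP y\<in>S. ennreal (mdist m x y))"

definition r_disjoint :: "'a metric \<Rightarrow> real \<Rightarrow> 'a set set \<Rightarrow> bool" where
  "r_disjoint m r \<U> \<longleftrightarrow>
     (\<forall>A\<in>\<U>. \<forall>B\<in>\<U>. A \<noteq> B \<longrightarrow> (\<forall>x\<in>A. \<forall>x'\<in>B. mdist m x x' > r))"

definition dim_AN_le :: "'a metric \<Rightarrow> nat \<Rightarrow> bool" where
  "dim_AN_le X m \<longleftrightarrow>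
     (\<exists>c\<ge>0. \<forall>r>0. \<exists>\<U> :: nat \<Rightarrow> 'a set set.
        (\<forall>i\<le>m. (\<forall>A\<in>\<U> i. A \<subseteq> mspace X) \<and> r_disjoint X r (\<U> i) \<and>
               (\<forall>A\<in>\<U> i. mdiameter X A \<le> ennreal (c * r))) \<and>
        (\<Union>i\<le>m. \<Union>(\<U> i)) = mspace X)"

(* The infimum in enat is attained when the set is nonempty, and is infinity otherwise. *)
definition dim_AN :: "'a metric \<Rightarrow> enat" where
  "dim_AN X = Inf {enat m | m. dim_AN_le X m}"

end

theory Submission
  imports Defs
begin

text \<open>
  Suppose that \<open>X\<close> has dimension at most \<open>m\<close> and put \<open>k = n * (m + 1)\<close>.  The bridge between
  \<open>X\<close> and \<open>Y\<close> is the description of the dimension by covers instead of disjoint families: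
  \<open>Y\<close> has dimension at most \<open>k - 1\<close> as soon as it has, at every scale \<open>\<rho>\<close>, a cover in which
  every point lies in at most \<open>k\<close> members, every \<open>\<rho>\<close>-ball lies in some member, and the diameters
  are at most linear in \<open>\<rho>\<close> (\<open>dim_AN_le_if_Lebesgue_covers\<close>).

  Such covers of \<open>Y\<close> are images of thickened families in \<open>X\<close> (\<open>Lebesgue_covers_image\<close>).  Let \<open>s\<close>
  bound the diameters of the lifts of \<open>\<rho>\<close>-balls, take families in \<open>X\<close> that are \<open>2 * s\<close>-disjoint,
  and thicken all their members by \<open>s\<close>.  A point of \<open>X\<close> still lies in at most one thickened set of
  each family, hence a point of \<open>Y\<close>, having at most \<open>n\<close> preimages, lies in at most \<open>n * (m + 1)\<close>
  of the images.  A \<open>\<rho>\<close>-ball of \<open>Y\<close> is the image of a small set \<open>A\<close>; any member of the families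
  that meets \<open>A\<close> swallows all of \<open>A\<close> once thickened, so its image contains the ball.  It is the
  multiplicity at points that is controlled here: the preimage of a ball may well be spread out,
  and only one small lift of it is under control.

  To return from covers to disjoint families, measure how deep a point lies in each member, that
  is, its distance to the complement, cut off at \<open>\<rho>\<close>.  At each point the largest depth is \<open>\<rho>\<close> and
  at most \<open>k\<close> depths are positive, so listing them in decreasing order there is a drop by at least
  \<open>\<rho> / k\<close> right after the \<open>j\<close>-th one, for some \<open>j\<close> from \<open>1\<close> to \<open>k\<close>.  Sort the points by the
  set of the \<open>j\<close> deepest members: for a fixed \<open>j\<close>, two points with different such sets see two
  members in opposite order with a margin of \<open>\<rho> / k\<close> each, and depth is 1-Lipschitz, so these
  points are at least \<open>\<rho> / k\<close> apart.  The values of \<open>j\<close> index the \<open>k\<close> families.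
\<close>

section \<open>Diameter bounds\<close>

lemma mdiameter_le_iff:
  assumes "K \<ge> 0"
  shows "mdiameter m S \<le> ennreal K \<longleftrightarrow> (\<forall>x\<in>S. \<forall>y\<in>S. mdist m x y \<le> K)"
  using assms by (simp add: mdiameter_def SUP_le_iff)

section \<open>Depth of a point in a set\<close>

text \<open>
  Inserting \<open>\<rho>\<close> both truncates the distance to the complement and gives the infimum a sensible
  value when \<open>W\<close> is the whole space.
\<close>
definition depth :: "'a metric \<Rightarrow> real \<Rightarrow> 'a set \<Rightarrow> 'a \<Rightarrow> real" where
  "depth m \<rho> W y = Inf (insert \<rho> (mdist m y ` (mspace m - W)))"

lemma bdd_below_depth: "bdd_below (insert \<rho> (mdist m y ` S))"
  by (simp add: bdd_below.I2[of _ 0])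

lemma depth_le: "depth m \<rho> W y \<le> \<rho>"
  unfolding depth_def by (rule cInf_lower[OF _ bdd_below_depth]) simp

lemma depth_le_mdist:
  assumes "z \<in> mspace m" "z \<notin> W"
  shows "depth m \<rho> W y \<le> mdist m y z"
  unfolding depth_def by (rule cInf_lower[OF _ bdd_below_depth]) (use assms in auto)

lemma depth_geI:
  assumes "a \<le> \<rho>" "\<And>z. z \<in> mspace m \<Longrightarrow> z \<notin> W \<Longrightarrow> a \<le> mdist m y z"
  shows "a \<le> depth m \<rho> W y"
  unfolding depth_def by (rule cInf_greatest) (use assms in auto)

lemma depth_pos_imp_mem:
  assumes "y \<in> mspace m" "0 < depth m \<rho> W y"
  shows "y \<in> W"
proof (rule ccontr)
  assume "y \<notin> W"
  then have "depth m \<rho> W y \<le> mdist m y y"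
    using assms by (intro depth_le_mdist) auto
  moreover have "mdist m y y = 0"
    using assms by simp
  ultimately show False
    using assms by linarith
qed

lemma depth_eq_if_ball_subset:
  assumes "y \<in> mspace m" "mball_of m y \<rho> \<subseteq> W"
  shows "depth m \<rho> W y = \<rho>"
proof (rule antisym[OF depth_le depth_geI])
  show "\<rho> \<le> mdist m y z" if "z \<in> mspace m" "z \<notin> W" for z
    using that assms by (auto simp: subset_iff not_less[symmetric])
qed simp

lemma depth_Lipschitz:
  assumes "x \<in> mspace m" "y \<in> mspace m"
  shows "depth m \<rho> W x \<le> depth m \<rho> W y + mdist m x y"
proof -
  have "depth m \<rho> W x - mdist m x y \<le> depth m \<rho> W y"
  proof (rule depth_geI)
    show "depth m \<rho> W x - mdist m x y \<le> \<rho>"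
      using depth_le[of m \<rho> W x] mdist_nonneg[of m x y] by linarith
    fix z assume z: "z \<in> mspace m" "z \<notin> W"
    show "depth m \<rho> W x - mdist m x y \<le> mdist m y z"
      using depth_le_mdist[OF z, of \<rho> x] mdist_triangle[OF assms z(1)] by linarith
  qed
  then show ?thesis by linarith
qed

section \<open>From covers with bounded multiplicity to disjoint families\<close>

text \<open>
  The covers that replace disjoint families: they have Lebesgue number \<open>\<rho>\<close>, mesh linear in \<open>\<rho>\<close>,
  and multiplicity at most \<open>k\<close>, counted at points.
\<close>
definition Lebesgue_covers :: "'a metric \<Rightarrow> nat \<Rightarrow> bool" where
  "Lebesgue_covers m k \<longleftrightarrow>
     (\<exists>C\<ge>0. \<forall>\<rho>>0. \<exists>\<W>. (\<forall>W\<in>\<W>. mdiameter m W \<le> ennreal (C * \<rho>)) \<and>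
        (\<forall>y\<in>mspace m. finite {W\<in>\<W>. y \<in> W} \<and> card {W\<in>\<W>. y \<in> W} \<le> k \<and>
           (\<exists>W\<in>\<W>. mball_of m y \<rho> \<subseteq> W)))"

text \<open>
  With at most \<open>k\<close> numbers, the \<open>k\<close> open intervals of length \<open>\<rho> / k\<close> that make up the range
  from \<open>0\<close> to \<open>\<rho>\<close> cannot all be hit: the value \<open>\<rho>\<close> itself uses up one of the \<open>k\<close> members and
  lies in none of the intervals.
\<close>
lemma exists_gap:
  fixes g :: "'b \<Rightarrow> real"
  assumes F: "finite F" "card F \<le> k" and W0: "W0 \<in> F" "g W0 = \<rho>"
  shows "\<exists>j\<in>{1..k}. \<forall>W\<in>F. g W \<ge> \<rho> - real (j - 1) * (\<rho> / k) \<or> g W \<le> \<rho> - real j * (\<rho> / k)"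
proof (rule ccontr)
  define \<delta> where "\<delta> = \<rho> / k"
  assume "\<not> ?thesis"
  then have "\<forall>j\<in>{1..k}. \<exists>W\<in>F. g W < \<rho> - real (j - 1) * \<delta> \<and> \<rho> - real j * \<delta> < g W"
    unfolding \<delta>_def by (simp add: not_le)
  then obtain h where h: "\<And>j. j \<in> {1..k} \<Longrightarrow> h j \<in> F"
      "\<And>j. j \<in> {1..k} \<Longrightarrow> g (h j) < \<rho> - real (j - 1) * \<delta>"
      "\<And>j. j \<in> {1..k} \<Longrightarrow> \<rho> - real j * \<delta> < g (h j)"
    by metis
  have "k > 0"
    using F W0 by (metis card_gt_0_iff empty_iff le_zero_eq gr0I)
  then have one: "1 \<in> {1..k}" by simp
  have \<delta>: "\<delta> > 0"
    using h(2,3)[OF one] by simp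
  have less: "g (h j) < g (h i)" if "i \<in> {1..k}" "j \<in> {1..k}" "i < j" for i j
  proof -
    have "real i * \<delta> \<le> real (j - 1) * \<delta>"
      using that \<delta> by (intro mult_right_mono) auto
    then show ?thesis
      using h(2)[OF that(2)] h(3)[OF that(1)] by linarith
  qed
  have "inj_on h {1..k}"
    by (rule inj_onI) (metis less less_irrefl nat_neq_iff)
  moreover have "h ` {1..k} \<subseteq> F - {W0}"
  proof
    fix W assume "W \<in> h ` {1..k}"
    then obtain j where j: "j \<in> {1..k}" "W = h j" by auto
    have "0 \<le> real (j - 1) * \<delta>"
      using \<delta> by simp
    then have "g W < \<rho>"
      using h(2)[OF j(1)] unfolding j(2) by linarith
    then show "W \<in> F - {W0}"
      using h(1)[OF j(1)] j(2) W0(2) by auto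
  qed
  ultimately have "k \<le> card (F - {W0})"
    using F(1) by (metis card_atLeastAtMost card_image card_mono diff_Suc_1 finite_Diff)
  then show False
    using F W0(1) \<open>k > 0\<close> by simp
qed

text \<open>
  The points for which the members of \<open>S\<close> lead those outside \<open>S\<close> by a margin of \<open>\<delta>\<close>.  The separate
  lower bound on the depth is what confines the set to the members of \<open>S\<close> when no member of the
  cover is left outside \<open>S\<close>.
\<close>
definition leading_set :: "'a metric \<Rightarrow> real \<Rightarrow> real \<Rightarrow> 'a set set \<Rightarrow> 'a set set \<Rightarrow> 'a set" where
  "leading_set m \<rho> \<delta> \<W> S =
     {y \<in> mspace m. (\<forall>W\<in>S. \<delta> \<le> depth m \<rho> W y) \<and>
        (\<forall>W\<in>S. \<forall>W'\<in>\<W> - S. depth m \<rho> W' y + \<delta> \<le> depth m \<rho> W y)}"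

lemma leading_setD:
  assumes "y \<in> leading_set m \<rho> \<delta> \<W> S" "W \<in> S" "W' \<in> \<W>" "W' \<notin> S"
  shows "depth m \<rho> W' y + \<delta> \<le> depth m \<rho> W y"
  using assms by (simp add: leading_set_def)

lemma leading_set_subset:
  assumes "W \<in> S" "\<delta> > 0"
  shows "leading_set m \<rho> \<delta> \<W> S \<subseteq> W"
proof
  fix y assume "y \<in> leading_set m \<rho> \<delta> \<W> S"
  then have y: "y \<in> mspace m" and "\<delta> \<le> depth m \<rho> W y"
    using assms(1) by (simp_all add: leading_set_def)
  then have "0 < depth m \<rho> W y"
    using assms(2) by linarith
  then show "y \<in> W"
    by (rule depth_pos_imp_mem[OF y])
qed

text \<open>
  Sets of equal finite cardinality are incomparable, so each of \<open>S\<close> and \<open>T\<close> has a member that the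
  other lacks; between the two points the order of the depths in these members is reversed.
\<close>
lemma leading_set_separated:
  assumes ST: "S \<subseteq> \<W>" "T \<subseteq> \<W>" "finite S" "finite T" "card S = card T" "S \<noteq> T"
    and x: "x \<in> leading_set m \<rho> \<delta> \<W> S" and y: "y \<in> leading_set m \<rho> \<delta> \<W> T"
  shows "\<delta> \<le> mdist m x y"
proof -
  have "\<not> S \<subseteq> T" "\<not> T \<subseteq> S"
    using card_subset_eq[of T S] card_subset_eq[of S T] ST(3-6) by auto
  then obtain W W' where W: "W \<in> S" "W \<notin> T" and W': "W' \<in> T" "W' \<notin> S"
    by blast
  have xy: "x \<in> mspace m" "y \<in> mspace m"
    using x y by (simp_all add: leading_set_def)
  have "depth m \<rho> W' x + \<delta> \<le> depth m \<rho> W x"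
    using leading_setD[OF x W(1) _ W'(2)] W'(1) ST(2) by blast
  moreover have "depth m \<rho> W y + \<delta> \<le> depth m \<rho> W' y"
    using leading_setD[OF y W'(1) _ W(2)] W(1) ST(1) by blast
  moreover have "depth m \<rho> W x \<le> depth m \<rho> W y + mdist m x y"
    by (rule depth_Lipschitz[OF xy])
  moreover have "depth m \<rho> W' y \<le> depth m \<rho> W' x + mdist m x y"
    using depth_Lipschitz[OF xy(2,1), of \<rho> W'] mdist_commute[of m x y] by simp
  ultimately show ?thesis by linarith
qed

text \<open>
  Take for \<open>S\<close> the members whose depth at \<open>y\<close> lies above the interval that \<open>exists_gap\<close> finds free
  of depths.  The upper end of that interval is at least \<open>\<rho> / k\<close>, so these depths are positive and \<open>S\<close> consists of members
  through \<open>y\<close>; it contains \<open>W0\<close>, the depth in \<open>W0\<close> being \<open>\<rho>\<close>.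
\<close>
lemma leading_sets_cover:
  assumes "\<rho> > 0" and y: "y \<in> mspace m"
    and mult: "finite {W\<in>\<W>. y \<in> W}" "card {W\<in>\<W>. y \<in> W} \<le> k"
    and W0: "W0 \<in> \<W>" "mball_of m y \<rho> \<subseteq> W0"
  shows "\<exists>S\<subseteq>\<W>. finite S \<and> card S \<in> {1..k} \<and> y \<in> leading_set m \<rho> (\<rho> / k) \<W> S"
proof -
  define g where "g = (\<lambda>W. depth m \<rho> W y)"
  define \<delta> where "\<delta> = \<rho> / k"
  let ?F = "{W\<in>\<W>. y \<in> W}"
  have gW0: "g W0 = \<rho>"
    unfolding g_def by (rule depth_eq_if_ball_subset[OF y W0(2)])
  have pos_mem: "W \<in> ?F" if "W \<in> \<W>" "g W > 0" for W
    using that depth_pos_imp_mem[OF y] by (auto simp: g_def)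
  have "W0 \<in> ?F"
    using pos_mem W0(1) gW0 \<open>\<rho> > 0\<close> by simp
  then obtain j where j: "j \<in> {1..k}"
    and gap: "\<And>W. W \<in> ?F \<Longrightarrow> g W \<ge> \<rho> - real (j - 1) * \<delta> \<or> g W \<le> \<rho> - real j * \<delta>"
    using exists_gap[OF mult, of W0 g \<rho>] gW0 unfolding \<delta>_def by blast
  have \<delta>: "\<delta> > 0" and k\<delta>: "real k * \<delta> = \<rho>"
    using j \<open>\<rho> > 0\<close> by (auto simp: \<delta>_def)
  have "real j * \<delta> \<le> real k * \<delta>"
    using j \<delta> by (intro mult_right_mono) auto
  then have j\<delta>: "real j * \<delta> \<le> \<rho>"
    using k\<delta> by simp
  have j1: "real (j - 1) * \<delta> = real j * \<delta> - \<delta>"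
    using j by (simp add: of_nat_diff algebra_simps)
  define S where "S = {W\<in>\<W>. g W \<ge> \<rho> - real (j - 1) * \<delta>}"
  have S_ge: "\<delta> \<le> g W" if "W \<in> S" for W
    using that j\<delta> j1 by (simp add: S_def)
  have "S \<subseteq> ?F"
  proof
    fix W assume "W \<in> S"
    then show "W \<in> ?F"
      using S_ge[of W] \<delta> by (intro pos_mem) (auto simp: S_def)
  qed
  then have S: "finite S" "card S \<le> k"
    using mult by (auto intro: finite_subset card_mono[THEN order_trans])
  have "real (j - 1) * \<delta> \<ge> 0"
    using \<delta> by simp
  then have "W0 \<in> S"
    using W0(1) gW0 by (simp add: S_def)
  then have "card S \<ge> 1"
    using S(1) by (metis One_nat_def Suc_leI card_gt_0_iff empty_iff)
  moreover have "g W' + \<delta> \<le> g W" if "W \<in> S" "W' \<in> \<W> - S" for W W'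
  proof (cases "g W' > 0")
    case True
    then have "g W' \<le> \<rho> - real j * \<delta>"
      using gap[OF pos_mem[of W']] that by (auto simp: S_def)
    then show ?thesis
      using that j1 by (auto simp: S_def)
  next
    case False
    then show ?thesis
      using S_ge[OF that(1)] by simp
  qed
  ultimately show ?thesis
    using S S_ge y unfolding leading_set_def g_def \<delta>_def
    by (intro exI[of _ S]) (auto simp: S_def)
qed

text \<open>
  The cover is used at scale \<open>2 * k * r\<close>, so that the margin \<open>2 * r\<close> exceeds \<open>r\<close> strictly, as
  disjointness demands.
\<close>
lemma dim_AN_le_if_Lebesgue_covers:
  assumes "k \<ge> 1" "Lebesgue_covers m k"
  shows "dim_AN_le m (k - 1)"
proof -
  obtain C where "C \<ge> 0"
    and covers: "\<forall>\<rho>>0. \<exists>\<W>. (\<forall>W\<in>\<W>. mdiameter m W \<le> ennreal (C * \<rho>)) \<and>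
       (\<forall>y\<in>mspace m. finite {W\<in>\<W>. y \<in> W} \<and> card {W\<in>\<W>. y \<in> W} \<le> k \<and>
          (\<exists>W\<in>\<W>. mball_of m y \<rho> \<subseteq> W))"
    using assms(2) unfolding Lebesgue_covers_def by (elim exE conjE) (rule that)
  show ?thesis
    unfolding dim_AN_le_def
  proof (intro exI[of _ "C * (2 * real k)"] conjI allI impI)
    show "0 \<le> C * (2 * real k)"
      using \<open>C \<ge> 0\<close> by simp
    fix r :: real assume r: "r > 0"
    define \<rho> where "\<rho> = 2 * real k * r"
    have \<rho>: "\<rho> > 0" "\<rho> / k = 2 * r"
      using r \<open>k \<ge> 1\<close> by (auto simp: \<rho>_def)
    obtain \<W> where diam: "\<And>W. W \<in> \<W> \<Longrightarrow> mdiameter m W \<le> ennreal (C * \<rho>)"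
      and mult: "\<And>y. y \<in> mspace m \<Longrightarrow> finite {W\<in>\<W>. y \<in> W}"
         "\<And>y. y \<in> mspace m \<Longrightarrow> card {W\<in>\<W>. y \<in> W} \<le> k"
      and Leb: "\<And>y. y \<in> mspace m \<Longrightarrow> \<exists>W\<in>\<W>. mball_of m y \<rho> \<subseteq> W"
      using covers[rule_format, OF \<rho>(1)] by blast
    define V where "V = leading_set m \<rho> (2 * r) \<W>"
    \<comment> \<open>Sets of leading members are nonempty, so the families are numbered by cardinality minus one.\<close>
    define \<U> where "\<U> = (\<lambda>i. V ` {S. S \<subseteq> \<W> \<and> finite S \<and> card S = Suc i})"
    have V_space: "V S \<subseteq> mspace m" for S
      by (auto simp: V_def leading_set_def)
    have sub: "A \<subseteq> mspace m" if "A \<in> \<U> i" for A i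
      using that V_space by (auto simp: \<U>_def)
    have disj: "r_disjoint m r (\<U> i)" for i
      unfolding r_disjoint_def
    proof (intro ballI impI)
      fix A B x x'
      assume AB: "A \<in> \<U> i" "B \<in> \<U> i" "A \<noteq> B" and x: "x \<in> A" "x' \<in> B"
      obtain S T where "S \<subseteq> \<W>" "finite S" "card S = Suc i" "A = V S"
        "T \<subseteq> \<W>" "finite T" "card T = Suc i" "B = V T"
        using AB by (auto simp: \<U>_def)
      with AB x have "2 * r \<le> mdist m x x'"
        by (intro leading_set_separated[of S \<W> T x m \<rho> "2 * r" x']) (auto simp: V_def)
      then show "r < mdist m x x'"
        using r by linarith
    qed
    have diam\<U>: "mdiameter m A \<le> ennreal (C * (2 * real k) * r)" if A: "A \<in> \<U> i" for A i
    proof -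
      obtain S where S: "S \<subseteq> \<W>" "card S = Suc i" "A = V S"
        using A by (auto simp: \<U>_def)
      then obtain W where W: "W \<in> S"
        by (metis card.empty ex_in_conv nat.distinct(1))
      have "A \<subseteq> W"
        unfolding S(3) V_def using r by (intro leading_set_subset[OF W]) simp
      then have "mdiameter m A \<le> mdiameter m W"
        unfolding mdiameter_def by (intro SUP_subset_mono) auto
      also have "\<dots> \<le> ennreal (C * (2 * real k) * r)"
        using diam[of W] W S(1) by (auto simp: \<rho>_def mult_ac)
      finally show ?thesis .
    qed
    have cover: "(\<Union>i\<le>k - 1. \<Union> (\<U> i)) = mspace m"
    proof
      show "(\<Union>i\<le>k - 1. \<Union> (\<U> i)) \<subseteq> mspace m"
        using sub by blast
      show "mspace m \<subseteq> (\<Union>i\<le>k - 1. \<Union> (\<U> i))"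
      proof
        fix y assume y: "y \<in> mspace m"
        obtain W0 where "W0 \<in> \<W>" "mball_of m y \<rho> \<subseteq> W0"
          using Leb[OF y] by blast
        then obtain S where S: "S \<subseteq> \<W>" "finite S" "card S \<in> {1..k}" "y \<in> V S"
          using leading_sets_cover[OF \<rho>(1) y mult[OF y]] unfolding V_def \<rho>(2) by blast
        then have "card S - 1 \<le> k - 1" "V S \<in> \<U> (card S - 1)"
          by (auto simp: \<U>_def)
        then show "y \<in> (\<Union>i\<le>k - 1. \<Union> (\<U> i))"
          using S(4) by blast
      qed
    qed
    show "\<exists>\<U>. (\<forall>i\<le>k - 1. (\<forall>A\<in>\<U> i. A \<subseteq> mspace m) \<and> r_disjoint m r (\<U> i) \<and>
         (\<forall>A\<in>\<U> i. mdiameter m A \<le> ennreal (C * (2 * real k) * r))) \<and>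
         (\<Union>i\<le>k - 1. \<Union> (\<U> i)) = mspace m"
      by (intro exI[of _ \<U>] conjI allI impI ballI sub disj diam\<U> cover)
  qed
qed

section \<open>Pushing a cover forward\<close>

definition thicken :: "'a metric \<Rightarrow> real \<Rightarrow> 'a set \<Rightarrow> 'a set" where
  "thicken m s U = {x \<in> mspace m. \<exists>u\<in>U. mdist m u x \<le> s}"

lemma mdist_thicken_le:
  assumes U: "U \<subseteq> mspace m" "V \<subseteq> mspace m"
    and UV: "\<And>u v. u \<in> U \<Longrightarrow> v \<in> V \<Longrightarrow> mdist m u v \<le> K"
    and x: "x \<in> thicken m s U" and y: "y \<in> thicken m s V"
  shows "mdist m x y \<le> K + 2 * s"
proof -
  obtain u v where u: "u \<in> U" "mdist m u x \<le> s" and v: "v \<in> V" "mdist m v y \<le> s"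
    using x y by (auto simp: thicken_def)
  have mem: "x \<in> mspace m" "y \<in> mspace m" "u \<in> mspace m" "v \<in> mspace m"
    using x y u v U by (auto simp: thicken_def)
  show ?thesis
    using mdist_triangle[OF mem(1,3,2)] mdist_triangle[OF mem(3,4,2)] UV[OF u(1) v(1)] u v
    by (simp add: mdist_commute)
qed

lemma thicken_disjoint:
  assumes \<U>: "r_disjoint m r \<U>" "\<And>U. U \<in> \<U> \<Longrightarrow> U \<subseteq> mspace m" and s: "2 * s \<le> r"
    and UV: "U \<in> \<U>" "V \<in> \<U>" and x: "x \<in> thicken m s U" "x \<in> thicken m s V"
  shows "U = V"
proof (rule ccontr)
  assume neq: "U \<noteq> V"
  obtain u v where u: "u \<in> U" "mdist m u x \<le> s" and v: "v \<in> V" "mdist m v x \<le> s"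
    using x by (auto simp: thicken_def)
  have mem: "x \<in> mspace m" "u \<in> mspace m" "v \<in> mspace m"
    using x u v UV \<U>(2) by (auto simp: thicken_def)
  have "mdist m u v \<le> 2 * s"
    using mdist_triangle[OF mem(2,1,3)] u v by (simp add: mdist_commute)
  moreover have "r < mdist m u v"
    using \<U>(1) UV neq u v unfolding r_disjoint_def by blast
  ultimately show False
    using s by linarith
qed

text \<open>
  Each preimage of \<open>y\<close> and each index contribute at most one set, whence the product.
\<close>
lemma card_images_at_point_le:
  assumes fin: "finite {x\<in>M. f x = y}" "card {x\<in>M. f x = y} \<le> n"
    and sub: "\<And>i U. i \<le> m \<Longrightarrow> U \<in> \<N> i \<Longrightarrow> U \<subseteq> M"
    and uniq: "\<And>i U V x. i \<le> m \<Longrightarrow> U \<in> \<N> i \<Longrightarrow> V \<in> \<N> i \<Longrightarrow> x \<in> U \<Longrightarrow> x \<in> V \<Longrightarrow> U = V"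
  shows "finite {W \<in> (\<Union>i\<le>m. image f ` \<N> i). y \<in> W} \<and>
    card {W \<in> (\<Union>i\<le>m. image f ` \<N> i). y \<in> W} \<le> n * (m + 1)"
proof -
  let ?P = "{x\<in>M. f x = y} \<times> {..m}"
  \<comment> \<open>The choice is arbitrary when no member of the family contains the point; this only adds
      superfluous sets to the image.\<close>
  define h where "h = (\<lambda>(x, i). f ` (SOME U. U \<in> \<N> i \<and> x \<in> U))"
  have sub_h: "{W \<in> (\<Union>i\<le>m. image f ` \<N> i). y \<in> W} \<subseteq> h ` ?P"
  proof
    fix W assume "W \<in> {W \<in> (\<Union>i\<le>m. image f ` \<N> i). y \<in> W}"
    then obtain i U x where W: "i \<le> m" "U \<in> \<N> i" "W = f ` U" "x \<in> U" "f x = y"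
      by auto
    have "(SOME V. V \<in> \<N> i \<and> x \<in> V) = U"
      using W uniq by (intro some_equality) auto
    then have "W = h (x, i)"
      by (simp add: h_def W(3))
    then show "W \<in> h ` ?P"
      using W sub by blast
  qed
  have P: "finite ?P" "card ?P \<le> n * (m + 1)"
    using fin mult_le_mono1[OF fin(2), of "m + 1"] by (simp_all add: card_cartesian_product)
  have "card {W \<in> (\<Union>i\<le>m. image f ` \<N> i). y \<in> W} \<le> card ?P"
    using surj_card_le[OF P(1) sub_h] .
  then show ?thesis
    using P finite_subset[OF sub_h] by auto
qed

text \<open>
  The lift of a ball of radius \<open>\<rho>\<close>, which has diameter at most \<open>2 * \<rho>\<close>, has diameter at most
  \<open>2 * d * \<rho>\<close>.  This is the thickening width, and twice that, \<open>4 * d * \<rho>\<close>, is the scale at which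
  the families in \<open>X\<close> must be disjoint.
\<close>
lemma Lebesgue_covers_image:
  fixes f :: "'a \<Rightarrow> 'b"
  assumes X: "dim_AN_le X m"
    and f: "Lipschitz_continuous_map X Y f"
    and fin: "\<And>y. y \<in> mspace Y \<Longrightarrow>
       finite {x \<in> mspace X. f x = y} \<and> card {x \<in> mspace X. f x = y} \<le> n"
    and d: "d > 0"
    and lift: "\<And>r B. r > 0 \<Longrightarrow> B \<subseteq> mspace Y \<Longrightarrow> mdiameter Y B \<le> ennreal r \<Longrightarrow>
       \<exists>A\<subseteq>mspace X. mdiameter X A \<le> ennreal (d * r) \<and> f ` A = B"
  shows "Lebesgue_covers Y (n * (m + 1))"
proof -
  obtain L where L: "L > 0"
    "\<And>x y. x \<in> mspace X \<Longrightarrow> y \<in> mspace X \<Longrightarrow> mdist Y (f x) (f y) \<le> L * mdist X x y"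
    using f unfolding Lipschitz_continuous_map_pos by blast
  obtain c where c: "c \<ge> 0"
    and fam: "\<forall>r>0. \<exists>\<U>. (\<forall>i\<le>m. (\<forall>A\<in>\<U> i. A \<subseteq> mspace X) \<and>
        r_disjoint X r (\<U> i) \<and> (\<forall>A\<in>\<U> i. mdiameter X A \<le> ennreal (c * r))) \<and>
        (\<Union>i\<le>m. \<Union> (\<U> i)) = mspace X"
    using X unfolding dim_AN_le_def by (elim exE conjE) (rule that)
  define C where "C = L * (c * (4 * d) + 4 * d)"
  show ?thesis
    unfolding Lebesgue_covers_def
  proof (intro exI[of _ C] conjI allI impI)
    show C: "C \<ge> 0"
      using L c d by (simp add: C_def)
    fix \<rho> :: real assume \<rho>: "\<rho> > 0"
    define s where "s = 2 * d * \<rho>"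
    have s: "s > 0"
      using d \<rho> by (simp add: s_def)
    obtain \<U> where fam\<U>: "\<forall>i\<le>m. (\<forall>A\<in>\<U> i. A \<subseteq> mspace X) \<and>
        r_disjoint X (2 * s) (\<U> i) \<and> (\<forall>A\<in>\<U> i. mdiameter X A \<le> ennreal (c * (2 * s)))"
      and \<U>_cover: "(\<Union>i\<le>m. \<Union> (\<U> i)) = mspace X"
      using fam[rule_format, of "2 * s"] s by fastforce
    have \<U>: "U \<in> \<U> i \<Longrightarrow> U \<subseteq> mspace X" "r_disjoint X (2 * s) (\<U> i)"
        "U \<in> \<U> i \<Longrightarrow> mdiameter X U \<le> ennreal (c * (2 * s))" if "i \<le> m" for i U
      using fam\<U> that by blast+
    define \<N> where "\<N> = (\<lambda>i. thicken X s ` \<U> i)"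
    define \<W> where "\<W> = (\<Union>i\<le>m. image f ` \<N> i)"
    have diam: "mdiameter Y W \<le> ennreal (C * \<rho>)" if "W \<in> \<W>" for W
    proof -
      obtain i U where U: "i \<le> m" "U \<in> \<U> i" "W = f ` thicken X s U"
        using \<open>W \<in> \<W>\<close> by (auto simp: \<W>_def \<N>_def)
      have "mdist X u v \<le> c * (2 * s)" if "u \<in> U" "v \<in> U" for u v
        using \<U>(3)[OF U(1,2)] that s c by (simp add: mdiameter_le_iff)
      then have *: "mdist X x x' \<le> c * (2 * s) + 2 * s"
        if "x \<in> thicken X s U" "x' \<in> thicken X s U" for x x'
        using \<U>(1)[OF U(1,2)] that by (intro mdist_thicken_le[of U X U])
      have "mdist Y (f x) (f x') \<le> C * \<rho>"
        if x: "x \<in> thicken X s U" "x' \<in> thicken X s U" for x x'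
      proof -
        have "mdist Y (f x) (f x') \<le> L * mdist X x x'"
          using x by (intro L(2)) (simp_all add: thicken_def)
        also have "\<dots> \<le> L * (c * (2 * s) + 2 * s)"
          using *[OF x] L(1) by (intro mult_left_mono) auto
        also have "\<dots> = C * \<rho>"
          by (simp add: C_def s_def algebra_simps)
        finally show ?thesis .
      qed
      moreover have "C * \<rho> \<ge> 0"
        using C \<rho> by simp
      ultimately show ?thesis
        unfolding U(3) by (subst mdiameter_le_iff) auto
    qed
    have mult: "finite {W\<in>\<W>. y \<in> W} \<and> card {W\<in>\<W>. y \<in> W} \<le> n * (m + 1)"
      if y: "y \<in> mspace Y" for y
      unfolding \<W>_def
    proof (rule card_images_at_point_le[where M = "mspace X"])
      show "finite {x \<in> mspace X. f x = y}" "card {x \<in> mspace X. f x = y} \<le> n"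
        using fin[OF y] by auto
      show "N \<subseteq> mspace X" if "i \<le> m" "N \<in> \<N> i" for i N
        using that by (auto simp: \<N>_def thicken_def)
      show "N = N'" if i: "i \<le> m" and N: "N \<in> \<N> i" "N' \<in> \<N> i" "x \<in> N" "x \<in> N'" for i N N' x
      proof -
        obtain U V where "U \<in> \<U> i" "V \<in> \<U> i" "N = thicken X s U" "N' = thicken X s V"
          using N by (auto simp: \<N>_def)
        with thicken_disjoint[OF \<U>(2)[OF i] \<U>(1)[OF i], of s U V x] N show ?thesis
          by simp
      qed
    qed
    have Leb: "\<exists>W\<in>\<W>. mball_of Y y \<rho> \<subseteq> W" if y: "y \<in> mspace Y" for y
    proof -
      have "mdist Y z z' \<le> 2 * \<rho>" if "z \<in> mball_of Y y \<rho>" "z' \<in> mball_of Y y \<rho>" for z z'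
        using that mdist_triangle[of z Y y z'] by (simp add: mdist_commute)
      then have "mdiameter Y (mball_of Y y \<rho>) \<le> ennreal (2 * \<rho>)"
        using \<rho> by (simp add: mdiameter_le_iff)
      moreover have "mball_of Y y \<rho> \<subseteq> mspace Y"
        by auto
      ultimately obtain A where A: "A \<subseteq> mspace X" "mdiameter X A \<le> ennreal (d * (2 * \<rho>))"
          "f ` A = mball_of Y y \<rho>"
        using lift[of "2 * \<rho>" "mball_of Y y \<rho>"] \<rho> by auto
      have A_dist: "mdist X a b \<le> s" if "a \<in> A" "b \<in> A" for a b
        using A(2) that s by (simp add: mdiameter_le_iff s_def mult_ac)
      have "y \<in> f ` A"
        unfolding A(3) in_mball_of using y \<rho> mdist_zero[OF y y] by metis
      then obtain a where a: "a \<in> A" by blast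
      then obtain i U where U: "i \<le> m" "U \<in> \<U> i" "a \<in> U"
        using A(1) \<U>_cover by blast
      have "A \<subseteq> thicken X s U"
        using A(1) A_dist a U(3) by (auto simp: thicken_def)
      then have "mball_of Y y \<rho> \<subseteq> f ` thicken X s U"
        using A(3) by blast
      moreover have "f ` thicken X s U \<in> \<W>"
        using U by (auto simp: \<W>_def \<N>_def)
      ultimately show ?thesis by blast
    qed
    show "\<exists>\<W>. (\<forall>W\<in>\<W>. mdiameter Y W \<le> ennreal (C * \<rho>)) \<and>
       (\<forall>y\<in>mspace Y. finite {W\<in>\<W>. y \<in> W} \<and> card {W\<in>\<W>. y \<in> W} \<le> n * (m + 1) \<and>
          (\<exists>W\<in>\<W>. mball_of Y y \<rho> \<subseteq> W))"
      using diam mult Leb by (intro exI[of _ \<W>] conjI ballI) auto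
  qed
qed

section \<open>The dimension inequality\<close>

lemma dim_AN_le_dim_AN:
  assumes "dim_AN X = enat m"
  shows "dim_AN_le X m"
proof -
  let ?D = "{enat m | m. dim_AN_le X m}"
  have "?D \<noteq> {}"
    using assms unfolding dim_AN_def Inf_enat_def by (auto split: if_splits)
  then obtain e where "e \<in> ?D" by blast
  then have "(LEAST e. e \<in> ?D) \<in> ?D"
    by (rule LeastI)
  then have "enat m \<in> ?D"
    using assms \<open>?D \<noteq> {}\<close> unfolding dim_AN_def Inf_enat_def by (simp only: if_False)
  then show ?thesis by simp
qed

lemma dim_AN_leI: "dim_AN_le X m \<Longrightarrow> dim_AN X \<le> enat m"
  unfolding dim_AN_def by (rule Inf_lower) blast

theorem theorem3p2:
  fixes n :: nat and X :: "'a metric" and Y :: "'b metric" and f :: "'a \<Rightarrow> 'b"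
  assumes "n \<ge> 1"
    and "Lipschitz_continuous_map X Y f"
    and "f ` mspace X = mspace Y"
    and "\<And>y. y \<in> mspace Y \<Longrightarrow>
           finite {x \<in> mspace X. f x = y} \<and> card {x \<in> mspace X. f x = y} \<le> n"
    and "\<exists>d>0. \<forall>r>0. \<forall>B\<subseteq>mspace Y. mdiameter Y B \<le> ennreal r \<longrightarrow>
           (\<exists>A\<subseteq>mspace X. mdiameter X A \<le> ennreal (d * r) \<and> f ` A = B)"
  shows "dim_AN Y \<le> (dim_AN X + 1) * enat n - 1"
proof (cases "dim_AN X")
  case (enat m)
  obtain d where d: "d > 0" and lift: "\<forall>r>0. \<forall>B\<subseteq>mspace Y. mdiameter Y B \<le> ennreal r \<longrightarrow>
       (\<exists>A\<subseteq>mspace X. mdiameter X A \<le> ennreal (d * r) \<and> f ` A = B)"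
    using assms(5) by (elim exE conjE) (rule that)
  have "Lebesgue_covers Y (n * (m + 1))"
    by (rule Lebesgue_covers_image[OF dim_AN_le_dim_AN[OF enat] assms(2,4) d lift[rule_format]])
  then have "dim_AN_le Y (n * (m + 1) - 1)"
    using \<open>n \<ge> 1\<close> by (intro dim_AN_le_if_Lebesgue_covers) simp_all
  then have "dim_AN Y \<le> enat (n * (m + 1) - 1)"
    by (rule dim_AN_leI)
  also have "\<dots> = (dim_AN X + 1) * enat n - 1"
    by (simp add: enat one_enat_def mult.commute)
  finally show ?thesis .
next
  case infinity
  then show ?thesis
    using \<open>n \<ge> 1\<close> by (simp add: imult_is_infinity enat_0_iff zero_enat_def one_enat_def)
qed

end
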